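(* Let $(X,d,\ll,\leq,\tau)$ be an intrinsic and quasi-strongly causal Lorentzian pre-length space and let $\Omega\colon X\to(0,+\infty)$ be any continuous function. Then $\tau_\Omega\colon X\times X\to[0,+\infty]$ is lower semicontinuous (with respect to the topology induced by $d$).
   Context: A Lorentzian pre-length space $(X,d,\ll,\leq,\tau)$ consists of a set $X$, a metric $d$ on $X$, two transitive relations $\ll,\leq$ on $X$ with $\leq$ reflexive and $\ll$ contained in $\leq$, and a map $\tau\colon X\times X\to[0,+\infty]$ which is lower semicontinuous with respect to the topology of $d$, satisfies $\tau(x,z)\geq\tau(x,y)+\tau(y,z)$ whenever $x\leq y\leq z$, satisfies $\tau(x,y)=0$ if $x\not\leq y$, and satisfies $\tau(x,y)>0$ if and only if $x\ll y$. A curve is a continuous map from an interval into $X$. A non-constant curve $\gamma\colon I\to X$ is causal if $\gamma(t)\leq\gamma(s)$ for all $t<s$ in $I$. A causal curve from $x$ to $y$ is one defined on a compact interval, starting at $x$ and ending at $y$. For a causal curve $\gamma\colon[a,b]\to X$ put $$L_\Omega^\tau(\gamma):=\inf\Big\{\sum_{i=0}^{m-1}\max_{t\in[t_i,t_{i+1}]}\Omega(\gamma(t))\,\tau(\gamma(t_i),\gamma(t_{i+1}))\ :\ a=t_0<\dots<t_m=b\Big\},$$ and let $L^\tau(\gamma)$ be the same quantity with $\Omega\equiv1$. Define $$\tau_\Omega(x,y):=\sup\big(\{0\}\cup\{L_\Omega^\tau(\gamma):\gamma\text{ a causal curve from }x\text{ to }y\}\big).$$ The space is intrinsic if $\tau(x,y)=\sup(\{0\}\cup\{L^\tau(\gamma):\gamma\text{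 a causal curve from }x\text{ to }y\})$ for all $x,y\in X$. It is quasi-strongly causal if for every $x\in X$ and every neighbourhood $U$ of $x$ there is a neighbourhood $V\subseteq U$ of $x$ such that every causal curve $\gamma\colon[a,b]\to X$ with $\gamma(a),\gamma(b)\in V$ satisfies $\gamma([a,b])\subseteq U$. *)

theory Defs
  imports "HOL-Analysis.Analysis"
begin

definition lower_semicontinuous ::
    "('a::topological_space \<Rightarrow> 'b::linorder) \<Rightarrow> bool" where
  "lower_semicontinuous f \<longleftrightarrow> (\<forall>x. \<forall>c<f x. eventually (\<lambda>y. c < f y) (nhds x))"

(* The set X is the carrier type and the metric d is its dist; the topology of X \<times> X
   is the product topology of the type 'a \<times> 'a. *)
locale lorentzian_pre_length_space =
  fixes chron :: "'a::metric_space \<Rightarrow> 'a \<Rightarrow> bool" (infix "\<lless>" 50)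
    and causal :: "'a \<Rightarrow> 'a \<Rightarrow> bool" (infix "\<preceq>" 50)
    and \<tau> :: "'a \<times> 'a \<Rightarrow> ennreal"
  assumes chron_trans: "x \<lless> y \<Longrightarrow> y \<lless> z \<Longrightarrow> x \<lless> z"
    and causal_trans: "x \<preceq> y \<Longrightarrow> y \<preceq> z \<Longrightarrow> x \<preceq> z"
    and causal_refl: "x \<preceq> x"
    and chron_imp_causal: "x \<lless> y \<Longrightarrow> x \<preceq> y"
    and lsc_tau: "lower_semicontinuous \<tau>"
    and reverse_triangle: "x \<preceq> y \<Longrightarrow> y \<preceq> z \<Longrightarrow> \<tau> (x, z) \<ge> \<tau> (x, y) + \<tau> (y, z)"
    and tau_eq_0: "\<not> x \<preceq> y \<Longrightarrow> \<tau> (x, y) = 0"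
    and tau_pos_iff: "\<tau> (x, y) > 0 \<longleftrightarrow> x \<lless> y"

(* As usual in HOL, a curve on the interval I is a function on all of real;
   its values outside I are irrelevant. *)
definition causal_curve ::
    "('a::metric_space \<Rightarrow> 'a \<Rightarrow> bool) \<Rightarrow> real set \<Rightarrow> (real \<Rightarrow> 'a) \<Rightarrow> bool" where
  "causal_curve le I \<gamma> \<longleftrightarrow>
     is_interval I \<and> continuous_on I \<gamma> \<and> \<not> \<gamma> constant_on I \<and>
     (\<forall>t\<in>I. \<forall>s\<in>I. t < s \<longrightarrow> le (\<gamma> t) (\<gamma> s))"

(* Non-constancy forces a < b. *)
definition causal_curve_from_to ::
    "('a::metric_space \<Rightarrow> 'a \<Rightarrow> bool) \<Rightarrow> real \<Rightarrow> real \<Rightarrow> (real \<Rightarrow> 'a) \<Rightarrow> 'a \<Rightarrow> 'a \<Rightarrow> bool" where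
  "causal_curve_from_to le a b \<gamma> x y \<longleftrightarrow>
     causal_curve le {a..b} \<gamma> \<and> \<gamma> a = x \<and> \<gamma> b = y"

definition is_partition :: "real \<Rightarrow> real \<Rightarrow> nat \<Rightarrow> (nat \<Rightarrow> real) \<Rightarrow> bool" where
  "is_partition a b m t \<longleftrightarrow> t 0 = a \<and> t m = b \<and> (\<forall>i<m. t i < t (Suc i))"

(* The supremum below is the maximum of \<Omega> \<circ> \<gamma> on [t i, t (i+1)] whenever \<Omega> and \<gamma> are
   continuous; it is taken in ennreal, \<Omega> being positive. *)
definition weighted_length ::
    "('a::metric_space \<times> 'a \<Rightarrow> ennreal) \<Rightarrow> ('a \<Rightarrow> real) \<Rightarrow> real \<Rightarrow> real \<Rightarrow> (real \<Rightarrow> 'a) \<Rightarrow> ennreal" where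
  "weighted_length \<tau> \<Omega> a b \<gamma> =
     Inf {(\<Sum>i<m. (SUP s\<in>{t i..t (Suc i)}. ennreal (\<Omega> (\<gamma> s))) * \<tau> (\<gamma> (t i), \<gamma> (t (Suc i)))) | m t.
          is_partition a b m t}"

definition conformal_tau ::
    "('a::metric_space \<Rightarrow> 'a \<Rightarrow> bool) \<Rightarrow> ('a \<times> 'a \<Rightarrow> ennreal) \<Rightarrow> ('a \<Rightarrow> real) \<Rightarrow> 'a \<times> 'a \<Rightarrow> ennreal" where
  "conformal_tau le \<tau> \<Omega> = (\<lambda>(x, y).
     Sup ({0} \<union> {weighted_length \<tau> \<Omega> a b \<gamma> | a b \<gamma>. causal_curve_from_to le a b \<gamma> x y}))"

definition tau_length ::
    "('a::metric_space \<times> 'a \<Rightarrow> ennreal) \<Rightarrow> real \<Rightarrow> real \<Rightarrow> (real \<Rightarrow> 'a) \<Rightarrow> ennreal" where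
  "tau_length \<tau> = weighted_length \<tau> (\<lambda>_. 1)"

definition intrinsic ::
    "('a::metric_space \<Rightarrow> 'a \<Rightarrow> bool) \<Rightarrow> ('a \<times> 'a \<Rightarrow> ennreal) \<Rightarrow> bool" where
  "intrinsic le \<tau> \<longleftrightarrow> (\<forall>x y. \<tau> (x, y) =
     Sup ({0} \<union> {tau_length \<tau> a b \<gamma> | a b \<gamma>. causal_curve_from_to le a b \<gamma> x y}))"

(* Neighbourhoods need not be open: U is a neighbourhood of x iff x \<in> interior U. *)
definition quasi_strongly_causal :: "('a::metric_space \<Rightarrow> 'a \<Rightarrow> bool) \<Rightarrow> bool" where
  "quasi_strongly_causal le \<longleftrightarrow>
     (\<forall>x U. x \<in> interior U \<longrightarrow>
        (\<exists>V. x \<in> interior V \<and> V \<subseteq> U \<and>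
           (\<forall>a b \<gamma>. causal_curve le {a..b} \<gamma> \<and> \<gamma> a \<in> V \<and> \<gamma> b \<in> V \<longrightarrow> \<gamma> ` {a..b} \<subseteq> U)))"

end

theory Submission
  imports Defs
begin

text \<open>
  Write \<open>\<tau>\<^sub>\<Omega>\<close> for the conformal time separation. Its lower semicontinuity follows once both
  endpoints can be replaced by chronologically interior ones at no cost: if \<open>c < \<tau>\<^sub>\<Omega>(x, y)\<close>, there
  are \<open>z\<close> and \<open>w\<close> with \<open>x \<lless> z\<close>, \<open>w \<lless> y\<close> and \<open>c < \<tau>\<^sub>\<Omega>(z, w)\<close>. Indeed, since \<open>\<tau>\<close> is lower
  semicontinuous, \<open>x' \<lless> z\<close> and \<open>w \<lless> y'\<close> persist for \<open>(x', y')\<close> near \<open>(x, y)\<close>; intrinsicness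
  provides causal curves from \<open>x'\<close> to \<open>z\<close> and from \<open>w\<close> to \<open>y'\<close>; and concatenation with these curves
  does not decrease \<open>\<tau>\<^sub>\<Omega>\<close> (\<open>conformal_tau_mono_left\<close>), so \<open>\<tau>\<^sub>\<Omega>(x', y') \<ge> \<tau>\<^sub>\<Omega>(z, w) > c\<close>. The
  hypotheses are symmetric under time reversal, so it suffices to find \<open>z\<close>
  (\<open>ex_chron_future_point\<close>).

  If \<open>x \<lless> x\<close>, take \<open>z = x\<close>. Otherwise take a causal curve \<open>\<gamma>\<close> from \<open>x\<close> to \<open>y\<close> with weighted length above \<open>c\<close>. It may start with a null
  piece; let \<open>p\<close> be the last point of \<open>\<gamma>\<close> that is not in the chronological future of \<open>x\<close>. The piece
  up to \<open>p\<close> has length zero, so the piece from \<open>p\<close> to \<open>y\<close> still has length above \<open>c\<close>, and every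
  later point of \<open>\<gamma>\<close> is an admissible \<open>z\<close>. The difficulty is that the length may drop when the
  starting point leaves \<open>p\<close>. If \<open>\<tau>\<^sub>\<Omega>(\<gamma>(t), y) \<le> c\<close> for all \<open>\<gamma>(t)\<close> after \<open>p\<close>, then the distances
  \<open>\<tau>(p, \<gamma>(t))\<close> are bounded below by a positive constant. Lower semicontinuity of \<open>\<tau>\<close> at
  \<open>(p, \<gamma>(t))\<close> and the reverse triangle inequality amplify this bound to \<open>\<tau>(p, \<gamma>(t)) = \<infinity>\<close>
  (\<open>tau_top_of_uniform_bound\<close>), and hence \<open>\<tau>(\<gamma>(s), \<gamma>(t))\<close> is arbitrarily large as \<open>\<gamma>(s)\<close>
  approaches \<open>p\<close>. The curve \<open>\<gamma>\<close> itself may be short between \<open>\<gamma>(s)\<close> and \<open>\<gamma>(t)\<close>, but by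
  intrinsicness other causal curves between these points are long, and if both points are close to
  \<open>p\<close>, quasi-strong causality keeps these curves in a region where \<open>\<Omega>\<close> is bounded away from zero
  (\<open>conformal_tau_local_bound\<close>). So \<open>\<tau>\<^sub>\<Omega>(\<gamma>(s), y) > c\<close> after all.
\<close>

section \<open>Partition sums\<close>

definition partition_sum ::
    "('a::metric_space \<times> 'a \<Rightarrow> ennreal) \<Rightarrow> ('a \<Rightarrow> real) \<Rightarrow> (real \<Rightarrow> 'a) \<Rightarrow> nat \<Rightarrow> (nat \<Rightarrow> real) \<Rightarrow> ennreal" where
  "partition_sum \<tau> \<Omega> \<gamma> m t =
     (\<Sum>i<m. (SUP s\<in>{t i..t (Suc i)}. ennreal (\<Omega> (\<gamma> s))) * \<tau> (\<gamma> (t i), \<gamma> (t (Suc i))))"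

lemma weighted_length_le_partition_sum:
  assumes "is_partition a b m t"
  shows "weighted_length \<tau> \<Omega> a b \<gamma> \<le> partition_sum \<tau> \<Omega> \<gamma> m t"
  unfolding weighted_length_def partition_sum_def by (rule Inf_lower) (use assms in blast)

lemma weighted_length_greatest:
  assumes "\<And>m t. is_partition a b m t \<Longrightarrow> c \<le> partition_sum \<tau> \<Omega> \<gamma> m t"
  shows "c \<le> weighted_length \<tau> \<Omega> a b \<gamma>"
  unfolding weighted_length_def
  by (rule Inf_greatest) (use assms in \<open>auto simp: partition_sum_def\<close>)

lemma is_partition_mono:
  assumes "is_partition a b m t" "i \<le> j" "j \<le> m"
  shows "t i \<le> t j"
  using assms(2,3)
proof (induction j rule: dec_induct)
  case (step n)
  then have "t n < t (Suc n)" using assms(1) by (auto simp: is_partition_def)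
  with step show ?case by simp
qed simp

lemma is_partition_bounds:
  assumes "is_partition a b m t" "i \<le> m"
  shows "a \<le> t i" "t i \<le> b"
  using is_partition_mono[OF assms(1), of 0 i] is_partition_mono[OF assms(1), of i m] assms
  by (auto simp: is_partition_def)

lemma weighted_length_trivial: "weighted_length \<tau> \<Omega> a a \<gamma> = 0"
proof -
  have "is_partition a a 0 (\<lambda>_. a)" by (simp add: is_partition_def)
  from weighted_length_le_partition_sum[OF this, of \<tau> \<Omega> \<gamma>] show ?thesis
    by (simp add: partition_sum_def)
qed

lemma weighted_length_le_one_step:
  assumes "a \<le> b"
  shows "weighted_length \<tau> \<Omega> a b \<gamma> \<le> (SUP s\<in>{a..b}. ennreal (\<Omega> (\<gamma> s))) * \<tau> (\<gamma> a, \<gamma> b)"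
proof (cases "a = b")
  case False
  then have "is_partition a b 1 (\<lambda>i. if i = 0 then a else b)"
    using assms by (simp add: is_partition_def)
  from weighted_length_le_partition_sum[OF this, of \<tau> \<Omega> \<gamma>] show ?thesis
    by (simp add: partition_sum_def)
qed (simp add: weighted_length_trivial)

text \<open>
  Partitions of \<open>[b, c]\<close> become partitions of \<open>[a, c]\<close> when the point \<open>a\<close> is prepended. This is the
  part of subadditivity of the length under which a single \<open>\<tau>\<close>-value controls the first piece.
\<close>

lemma weighted_length_le_first_step:
  assumes "a \<le> b"
  shows "weighted_length \<tau> \<Omega> a c \<gamma>
    \<le> (SUP s\<in>{a..b}. ennreal (\<Omega> (\<gamma> s))) * \<tau> (\<gamma> a, \<gamma> b) + weighted_length \<tau> \<Omega> b c \<gamma>"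
    (is "_ \<le> ?K + _")
proof (cases "a = b \<or> ?K = top")
  case True
  then show ?thesis by (auto simp: add_increasing)
next
  case False
  then have ab: "a < b" and K: "?K \<noteq> top" using assms by auto
  have "weighted_length \<tau> \<Omega> a c \<gamma> - ?K \<le> weighted_length \<tau> \<Omega> b c \<gamma>"
  proof (rule weighted_length_greatest)
    fix m t assume t: "is_partition b c m t"
    have "is_partition a c (Suc m) (case_nat a t)"
      using t ab by (auto simp: is_partition_def split: nat.split)
    from weighted_length_le_partition_sum[OF this, of \<tau> \<Omega> \<gamma>]
    have "weighted_length \<tau> \<Omega> a c \<gamma> \<le> ?K + partition_sum \<tau> \<Omega> \<gamma> m t"
      using t by (simp add: partition_sum_def sum.lessThan_Suc_shift is_partition_def del: sum.lessThan_Suc)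
    then show "weighted_length \<tau> \<Omega> a c \<gamma> - ?K \<le> partition_sum \<tau> \<Omega> \<gamma> m t"
      using K by (simp add: ennreal_minus_le_iff)
  qed
  then show ?thesis using K by (simp add: ennreal_minus_le_iff)
qed

lemma weighted_length_shift_le:
  assumes "\<And>s. s \<in> {c..d} \<Longrightarrow> \<delta> (s + h) = \<gamma> s"
  shows "weighted_length \<tau> \<Omega> c d \<gamma> \<le> weighted_length \<tau> \<Omega> (c + h) (d + h) \<delta>"
proof (rule weighted_length_greatest)
  fix m t assume t: "is_partition (c + h) (d + h) m t"
  let ?u = "\<lambda>i. t i - h"
  have u: "is_partition c d m ?u" using t by (auto simp: is_partition_def)
  have *: "\<delta> s = \<gamma> (s - h)" if "s \<in> {c + h..d + h}" for s
    using assms[of "s - h"] that by auto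
  have "partition_sum \<tau> \<Omega> \<gamma> m ?u = partition_sum \<tau> \<Omega> \<delta> m t"
    unfolding partition_sum_def
  proof (intro sum.cong refl)
    fix i assume "i \<in> {..<m}"
    then have b: "c + h \<le> t i" "t i \<le> d + h" "c + h \<le> t (Suc i)" "t (Suc i) \<le> d + h"
      using is_partition_bounds[OF t, of i] is_partition_bounds[OF t, of "Suc i"] by auto
    have "(\<lambda>s. ennreal (\<Omega> (\<gamma> s))) ` {?u i..?u (Suc i)}
        = (\<lambda>s. ennreal (\<Omega> (\<gamma> (s - h)))) ` {t i..t (Suc i)}"
      by (simp only: image_minus_const_atLeastAtMost'[symmetric] image_image)
    also have "\<dots> = (\<lambda>s. ennreal (\<Omega> (\<delta> s))) ` {t i..t (Suc i)}"
      by (rule image_cong) (use b in \<open>auto simp: *\<close>)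
    finally show "(SUP s\<in>{?u i..?u (Suc i)}. ennreal (\<Omega> (\<gamma> s))) * \<tau> (\<gamma> (?u i), \<gamma> (?u (Suc i)))
        = (SUP s\<in>{t i..t (Suc i)}. ennreal (\<Omega> (\<delta> s))) * \<tau> (\<delta> (t i), \<delta> (t (Suc i)))"
      using b by (simp add: *)
  qed
  then show "weighted_length \<tau> \<Omega> c d \<gamma> \<le> partition_sum \<tau> \<Omega> \<delta> m t"
    using weighted_length_le_partition_sum[OF u, of \<tau> \<Omega> \<gamma>] by simp
qed

section \<open>Causal paths\<close>

text \<open>
  In contrast to a causal curve, a causal path may be constant, so that every closed subinterval of
  a causal curve carries a causal path.
\<close>

definition causal_path ::
    "('a::metric_space \<Rightarrow> 'a \<Rightarrow> bool) \<Rightarrow> real \<Rightarrow> real \<Rightarrow> (real \<Rightarrow> 'a) \<Rightarrow> bool" where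
  "causal_path le a b \<gamma> \<longleftrightarrow> a \<le> b \<and> continuous_on {a..b} \<gamma> \<and>
     (\<forall>s\<in>{a..b}. \<forall>t\<in>{a..b}. s \<le> t \<longrightarrow> le (\<gamma> s) (\<gamma> t))"

lemma causal_path_subinterval:
  assumes "causal_path le a b \<gamma>" "a \<le> c" "c \<le> d" "d \<le> b"
  shows "causal_path le c d \<gamma>"
  using assms unfolding causal_path_def
  by (auto intro: continuous_on_subset)

lemma causal_curve_from_to_iff:
  assumes "\<And>x. le x x"
  shows "causal_curve_from_to le a b \<gamma> x y \<longleftrightarrow>
    causal_path le a b \<gamma> \<and> \<not> \<gamma> constant_on {a..b} \<and> \<gamma> a = x \<and> \<gamma> b = y"
proof -
  have "a \<le> b" if "\<not> \<gamma> constant_on {a..b}"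
    using that by (rule contrapos_np) (auto simp: constant_on_def)
  then show ?thesis
    unfolding causal_curve_from_to_def causal_curve_def causal_path_def
    using assms by (auto simp: le_less)
qed

lemma conformal_tau_ge_weighted_length:
  assumes "causal_curve_from_to le a b \<gamma> x y"
  shows "weighted_length \<tau> \<Omega> a b \<gamma> \<le> conformal_tau le \<tau> \<Omega> (x, y)"
  unfolding conformal_tau_def prod.case by (rule Sup_upper) (use assms in blast)

lemma less_conformal_tauE:
  assumes "c < conformal_tau le \<tau> \<Omega> (x, y)"
  obtains a b \<gamma> where "causal_curve_from_to le a b \<gamma> x y" "c < weighted_length \<tau> \<Omega> a b \<gamma>"
proof -
  from assms obtain l where "c < l"
    "l \<in> {0} \<union> {weighted_length \<tau> \<Omega> a b \<gamma> | a b \<gamma>. causal_curve_from_to le a b \<gamma> x y}"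
    unfolding conformal_tau_def prod.case less_Sup_iff by blast
  then show ?thesis using that by auto
qed

lemma lower_semicontinuous_tendsto:
  assumes "lower_semicontinuous f" "(g \<longlongrightarrow> l) F" "c < f l"
  shows "\<forall>\<^sub>F x in F. c < f (g x)"
proof -
  have "\<forall>\<^sub>F y in nhds l. c < f y"
    using assms(1,3) by (auto simp: lower_semicontinuous_def)
  then show ?thesis using assms(2) unfolding filterlim_iff by blast
qed

section \<open>The conformal time separation\<close>

text \<open>
  The hypotheses are bundled in a locale so that facts proved about the left endpoint can be
  transferred to the right endpoint by interpreting the locale for the time-reversed space.
\<close>

locale conformal_setting = lorentzian_pre_length_space chron causal \<tau>
  for chron :: "'a::metric_space \<Rightarrow> 'a \<Rightarrow> bool" (infix "\<lless>" 50)
    and causal :: "'a \<Rightarrow> 'a \<Rightarrow> bool" (infix "\<preceq>" 50)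
    and \<tau> :: "'a \<times> 'a \<Rightarrow> ennreal" +
  fixes \<Omega> :: "'a \<Rightarrow> real"
  assumes intr: "intrinsic causal \<tau>"
    and qsc: "quasi_strongly_causal causal"
    and contO: "continuous_on UNIV \<Omega>"
    and posO: "\<And>x. \<Omega> x > 0"
begin

abbreviation T\<Omega> where "T\<Omega> \<equiv> conformal_tau causal \<tau> \<Omega>"
abbreviation L\<Omega> where "L\<Omega> \<equiv> weighted_length \<tau> \<Omega>"

lemmas curve_iff = causal_curve_from_to_iff[of causal, OF causal_refl]

lemma tau_mono:
  assumes "x' \<preceq> x" "x \<preceq> y" "y \<preceq> y'"
  shows "\<tau> (x, y) \<le> \<tau> (x', y')"
proof -
  have "\<tau> (x, y) \<le> \<tau> (x', x) + \<tau> (x, y)" by simp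
  also have "\<dots> \<le> \<tau> (x', y)" by (rule reverse_triangle[OF assms(1,2)])
  also have "\<dots> \<le> \<tau> (x', y) + \<tau> (y, y')" by simp
  also have "\<dots> \<le> \<tau> (x', y')"
    by (rule reverse_triangle[OF causal_trans[OF assms(1,2)] assms(3)])
  finally show ?thesis .
qed

lemma chron_causal_trans:
  assumes "x \<lless> y" "y \<preceq> z"
  shows "x \<lless> z"
proof -
  have "0 < \<tau> (x, y)" using assms(1) by (simp add: tau_pos_iff)
  also have "\<dots> \<le> \<tau> (x, z)"
    by (rule tau_mono) (use assms causal_refl chron_imp_causal in auto)
  finally show ?thesis by (simp add: tau_pos_iff)
qed

lemma chron_imp_curve:
  assumes "x \<lless> y"
  obtains a b \<gamma> where "causal_curve_from_to causal a b \<gamma> x y"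
proof -
  have "0 < conformal_tau causal \<tau> (\<lambda>_. 1) (x, y)"
    using intr assms tau_pos_iff by (simp add: intrinsic_def tau_length_def conformal_tau_def)
  then show ?thesis using that by (elim less_conformal_tauE)
qed

text \<open>
  A partition of \<open>[a, c]\<close> induces one of \<open>[b, c]\<close> by dropping the points before \<open>b\<close> and starting at
  \<open>b\<close> instead. The piece that contains \<open>b\<close> shrinks, which lowers its \<open>\<tau>\<close>-value by the reverse
  triangle inequality.
\<close>

lemma weighted_length_restrict_right:
  assumes \<gamma>: "causal_path causal a c \<gamma>" and b: "a \<le> b" "b \<le> c"
  shows "L\<Omega> b c \<gamma> \<le> L\<Omega> a c \<gamma>"
proof (cases "b = c")
  case False
  show ?thesis
  proof (rule weighted_length_greatest)
    fix m t assume t: "is_partition a c m t"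
    (* the induced partition keeps the points from index k = j + 1 on *)
    define k where "k = (LEAST i. b < t i)"
    have m: "b < t m" using False b t by (simp add: is_partition_def)
    then have k: "b < t k" "k \<le> m" unfolding k_def by (auto intro: LeastI Least_le)
    have "k \<noteq> 0" using k(1) t b by (auto simp: is_partition_def intro!: Nat.gr0I)
    then obtain j where j: "k = Suc j" using not0_implies_Suc by blast
    have tj: "t j \<le> b" using not_less_Least[of j "\<lambda>i. b < t i"] j unfolding k_def by force
    define u where "u i = (if i = 0 then b else t (j + i))" for i
    have u: "is_partition b c (m - j) u"
      using t k j by (auto simp: is_partition_def u_def)
    let ?f = "\<lambda>t i. (SUP s\<in>{t i..t (Suc i)}. ennreal (\<Omega> (\<gamma> s))) * \<tau> (\<gamma> (t i), \<gamma> (t (Suc i)))"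
    have "L\<Omega> b c \<gamma> \<le> (\<Sum>i<m - j. ?f u i)"
      using weighted_length_le_partition_sum[OF u, of \<tau> \<Omega> \<gamma>] by (simp add: partition_sum_def)
    also have "\<dots> \<le> (\<Sum>i<m - j. ?f t (j + i))"
    proof (rule sum_mono)
      fix i assume "i \<in> {..<m - j}"
      then have i: "j + i < m" by auto
      have tu: "t (j + i) \<le> u i" using tj by (simp add: u_def)
      have us: "u (Suc i) = t (Suc (j + i))" by (simp add: u_def)
      have uu: "u i < u (Suc i)" using u i by (simp add: is_partition_def)
      have ac: "a \<le> t (j + i)" "t (Suc (j + i)) \<le> c"
        using is_partition_bounds[OF t, of "j + i"] is_partition_bounds[OF t, of "Suc (j + i)"] i by auto
      have "\<tau> (\<gamma> (u i), \<gamma> (u (Suc i))) \<le> \<tau> (\<gamma> (t (j + i)), \<gamma> (t (Suc (j + i))))"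
        by (rule tau_mono) (use \<gamma> tu us uu ac in \<open>auto simp: causal_path_def\<close>)
      moreover have "(SUP s\<in>{u i..u (Suc i)}. ennreal (\<Omega> (\<gamma> s)))
          \<le> (SUP s\<in>{t (j + i)..t (Suc (j + i))}. ennreal (\<Omega> (\<gamma> s)))"
        by (rule SUP_subset_mono) (use tu us in auto)
      ultimately show "?f u i \<le> ?f t (j + i)" by (intro mult_mono) auto
    qed
    also have "\<dots> = sum (?f t) ((\<lambda>i. j + i) ` {..<m - j})"
      by (simp add: sum.reindex)
    also have "\<dots> \<le> (\<Sum>i<m. ?f t i)"
      by (rule sum_mono2) auto
    finally show "L\<Omega> b c \<gamma> \<le> partition_sum \<tau> \<Omega> \<gamma> m t" by (simp add: partition_sum_def)
  qed
qed (simp add: weighted_length_trivial)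

text \<open>
  Concatenation of \<open>\<gamma>\<close> with a curve from \<open>z\<close> to \<open>y\<close> gives a curve from \<open>x\<close> to \<open>y\<close> that is at least
  as long as its second piece.
\<close>

lemma conformal_tau_mono_left:
  assumes \<gamma>: "causal_curve_from_to causal a b \<gamma> x z"
  shows "T\<Omega> (z, y) \<le> T\<Omega> (x, y)"
proof (rule ccontr)
  assume "\<not> ?thesis"
  then have "T\<Omega> (x, y) < T\<Omega> (z, y)" by simp
  then obtain c d \<eta> where \<eta>: "causal_curve_from_to causal c d \<eta> z y"
    and L: "T\<Omega> (x, y) < L\<Omega> c d \<eta>" by (rule less_conformal_tauE)
  define h where "h = b - c"
  define \<delta> where "\<delta> s = (if s \<le> b then \<gamma> s else \<eta> (s - h))" for s
  have g: "causal_path causal a b \<gamma>" "\<gamma> a = x" "\<gamma> b = z" "\<not> \<gamma> constant_on {a..b}"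
    and e: "causal_path causal c d \<eta>" "\<eta> c = z" "\<eta> d = y"
    using \<gamma> \<eta> curve_iff by auto
  have ab: "a \<le> b" and cd: "c \<le> d" using g e by (auto simp: causal_path_def)
  have shift: "\<delta> (s + h) = \<eta> s" if "s \<in> {c..d}" for s
    using that g e by (auto simp: \<delta>_def h_def)
  have mono: "\<delta> s \<preceq> \<delta> t" if "s \<in> {a..d + h}" "t \<in> {a..d + h}" "s \<le> t" for s t
  proof -
    have 1: "\<gamma> s \<preceq> \<gamma> t" if "t \<le> b" using that \<open>s \<in> _\<close> \<open>t \<in> _\<close> \<open>s \<le> t\<close> g by (auto simp: causal_path_def)
    have 2: "\<eta> (s - h) \<preceq> \<eta> (t - h)" if "b < s"
      using that \<open>s \<in> _\<close> \<open>t \<in> _\<close> \<open>s \<le> t\<close> e by (auto simp: causal_path_def h_def)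
    have 3: "\<gamma> s \<preceq> \<gamma> b" if "s \<le> b" using that \<open>s \<in> _\<close> g by (auto simp: causal_path_def)
    have 4: "\<eta> c \<preceq> \<eta> (t - h)" if "b < t" using that \<open>t \<in> _\<close> e by (auto simp: causal_path_def h_def)
    show ?thesis using 1 2 3 4 \<open>s \<le> t\<close> g e by (auto simp: \<delta>_def intro: causal_trans)
  qed
  have "continuous_on ({a..b} \<union> {b..d + h}) \<delta>"
    unfolding \<delta>_def
  proof (rule continuous_on_If)
    show "continuous_on {a..b} \<gamma>" using g by (simp add: causal_path_def)
    show "continuous_on {b..d + h} (\<lambda>s. \<eta> (s - h))"
      by (rule continuous_on_compose2[of "{c..d}" \<eta>])
         (use e in \<open>auto simp: causal_path_def h_def intro!: continuous_intros\<close>)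
  qed (use g e in \<open>auto simp: h_def\<close>)
  moreover have "{a..b} \<union> {b..d + h} = {a..d + h}" using ab cd by (auto simp: h_def)
  ultimately have path: "causal_path causal a (d + h) \<delta>"
    using ab cd mono by (auto simp: causal_path_def h_def)
  have "\<not> \<delta> constant_on {a..d + h}"
  proof
    assume "\<delta> constant_on {a..d + h}"
    then have "\<delta> constant_on {a..b}" by (rule constant_on_subset) (use cd in \<open>auto simp: h_def\<close>)
    then show False using g(4) by (auto simp: constant_on_def \<delta>_def)
  qed
  moreover have "\<delta> a = x" "\<delta> (d + h) = y"
    using ab g shift[of d] cd e by (auto simp: \<delta>_def)
  ultimately have "causal_curve_from_to causal a (d + h) \<delta> x y"
    using path curve_iff by blast
  then have "L\<Omega> a (d + h) \<delta> \<le> T\<Omega> (x, y)" by (rule conformal_tau_ge_weighted_length)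
  moreover have "L\<Omega> (c + h) (d + h) \<delta> \<le> L\<Omega> a (d + h) \<delta>"
    by (rule weighted_length_restrict_right[OF path]) (use ab cd in \<open>auto simp: h_def\<close>)
  moreover have "L\<Omega> c d \<eta> \<le> L\<Omega> (c + h) (d + h) \<delta>"
    by (rule weighted_length_shift_le) (rule shift)
  ultimately show False using L by (meson leD order_trans)
qed

text \<open>
  This is where quasi-strong causality and intrinsicness work together: causal curves between points
  of a small neighbourhood of \<open>p\<close> stay where \<open>\<Omega>\<close> exceeds half of its value at \<open>p\<close>, and their
  \<open>\<tau>\<close>-lengths approximate \<open>\<tau>\<close>.
\<close>

lemma conformal_tau_local_bound:
  obtains V k where "p \<in> interior V" "0 < k" "\<And>u v. u \<in> V \<Longrightarrow> v \<in> V \<Longrightarrow> ennreal k * \<tau> (u, v) \<le> T\<Omega> (u, v)"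
proof -
  define k where "k = \<Omega> p / 2"
  define U where "U = {q. k < \<Omega> q}"
  have k: "0 < k" using posO[of p] by (simp add: k_def)
  have "open U" unfolding U_def using contO by (intro open_Collect_less) auto
  then have "p \<in> interior U" using posO[of p] by (simp add: interior_open U_def k_def)
  then obtain V where V: "p \<in> interior V"
    and VU: "\<And>a b \<gamma>. causal_curve causal {a..b} \<gamma> \<Longrightarrow> \<gamma> a \<in> V \<Longrightarrow> \<gamma> b \<in> V \<Longrightarrow> \<gamma> ` {a..b} \<subseteq> U"
    using qsc unfolding quasi_strongly_causal_def by meson
  have "ennreal k * \<tau> (u, v) \<le> T\<Omega> (u, v)" if uv: "u \<in> V" "v \<in> V" for u v
  proof -
    have *: "ennreal k * tau_length \<tau> a b \<gamma> \<le> T\<Omega> (u, v)"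
      if \<gamma>: "causal_curve_from_to causal a b \<gamma> u v" for a b \<gamma>
    proof -
      have U: "\<gamma> ` {a..b} \<subseteq> U" using VU \<gamma> uv by (auto simp: causal_curve_from_to_def)
      have "ennreal k * tau_length \<tau> a b \<gamma> \<le> L\<Omega> a b \<gamma>"
      proof (rule weighted_length_greatest)
        fix m t assume t: "is_partition a b m t"
        have "ennreal k * tau_length \<tau> a b \<gamma> \<le> ennreal k * partition_sum \<tau> (\<lambda>_. 1) \<gamma> m t"
          unfolding tau_length_def by (intro mult_left_mono weighted_length_le_partition_sum t) simp
        also have "\<dots> \<le> partition_sum \<tau> \<Omega> \<gamma> m t"
          unfolding partition_sum_def sum_distrib_left
        proof (rule sum_mono)
          fix i assume i: "i \<in> {..<m}"
          have le: "t i < t (Suc i)" using t i by (simp add: is_partition_def)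
          have "t i \<in> {a..b}" using is_partition_bounds[OF t, of i] i by simp
          then have "k < \<Omega> (\<gamma> (t i))" using U unfolding U_def by blast
          then have "ennreal k \<le> ennreal (\<Omega> (\<gamma> (t i)))" by (simp add: ennreal_leI)
          also have "\<dots> \<le> (SUP s\<in>{t i..t (Suc i)}. ennreal (\<Omega> (\<gamma> s)))"
            by (rule SUP_upper) (use le in auto)
          finally have "ennreal k * \<tau> (\<gamma> (t i), \<gamma> (t (Suc i)))
              \<le> (SUP s\<in>{t i..t (Suc i)}. ennreal (\<Omega> (\<gamma> s))) * \<tau> (\<gamma> (t i), \<gamma> (t (Suc i)))"
            by (rule mult_right_mono) simp
          then show "ennreal k * ((SUP s\<in>{t i..t (Suc i)}. ennreal 1) * \<tau> (\<gamma> (t i), \<gamma> (t (Suc i))))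
              \<le> (SUP s\<in>{t i..t (Suc i)}. ennreal (\<Omega> (\<gamma> s))) * \<tau> (\<gamma> (t i), \<gamma> (t (Suc i)))"
            using le by (simp add: mult.assoc)
        qed
        finally show "ennreal k * tau_length \<tau> a b \<gamma> \<le> partition_sum \<tau> \<Omega> \<gamma> m t" .
      qed
      also have "\<dots> \<le> T\<Omega> (u, v)" by (rule conformal_tau_ge_weighted_length[OF \<gamma>])
      finally show ?thesis .
    qed
    let ?S = "{0} \<union> {tau_length \<tau> a b \<gamma> | a b \<gamma>. causal_curve_from_to causal a b \<gamma> u v}"
    have "\<tau> (u, v) = Sup ?S" using intr unfolding intrinsic_def by blast
    then have "ennreal k * \<tau> (u, v) = (SUP l\<in>?S. ennreal k * l)"
      using SUP_mult_left_ennreal[of "ennreal k" "\<lambda>l. l" ?S] by (simp only: image_ident)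
    also have "\<dots> \<le> T\<Omega> (u, v)" by (rule SUP_least) (use * in auto)
    finally show ?thesis .
  qed
  then show ?thesis using that V k by blast
qed

text \<open>
  Constant paths are not among the curves over which the supremum is taken, yet they may have
  positive length: if \<open>\<tau>(q, q) \<noteq> 0\<close>, the reverse triangle inequality forces \<open>\<tau>(q, q) = \<infinity>\<close>. In that
  case the local bound at \<open>q\<close> shows that the conformal time separation from \<open>q\<close> to \<open>q\<close> is infinite as
  well.
\<close>

lemma weighted_length_le_conformal_tau:
  assumes "causal_path causal a b \<gamma>"
  shows "L\<Omega> a b \<gamma> \<le> T\<Omega> (\<gamma> a, \<gamma> b)"
proof (cases "\<gamma> constant_on {a..b}")
  case False
  then show ?thesis
    using assms curve_iff conformal_tau_ge_weighted_length by blast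
next
  case True
  define q where "q = \<gamma> a"
  have ab: "a \<le> b" using assms by (simp add: causal_path_def)
  have q: "\<gamma> s = q" if "s \<in> {a..b}" for s using True that ab by (auto simp: constant_on_def q_def)
  have ends: "\<gamma> a = q" "\<gamma> b = q" using q ab by auto
  have dbl: "\<tau> (q, q) + \<tau> (q, q) \<le> \<tau> (q, q)" by (intro reverse_triangle causal_refl)
  show ?thesis
  proof (cases "\<tau> (q, q) = 0")
    case True
    then show ?thesis using weighted_length_le_one_step[OF ab, of \<tau> \<Omega> \<gamma>] ends by simp
  next
    case False
    have inf: "\<tau> (q, q) = top"
    proof (rule ccontr)
      assume "\<tau> (q, q) \<noteq> top"
      then have "\<tau> (q, q) < \<tau> (q, q) + \<tau> (q, q)" using False
        by (cases "\<tau> (q, q)") (auto simp: ennreal_plus[symmetric] ennreal_less_iff simp del: ennreal_plus)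
      then show False using dbl by simp
    qed
    obtain V k where V: "q \<in> interior V" "0 < k"
      "\<And>u v. u \<in> V \<Longrightarrow> v \<in> V \<Longrightarrow> ennreal k * \<tau> (u, v) \<le> T\<Omega> (u, v)"
      using conformal_tau_local_bound by blast
    then have "ennreal k * top \<le> T\<Omega> (q, q)" using interior_subset inf by (metis subsetD)
    then show ?thesis using V(2) ends by (simp add: ennreal_mult_top top_unique)
  qed
qed

lemma conformal_tau_path_mono_left:
  assumes "causal_path causal a b \<gamma>"
  shows "T\<Omega> (\<gamma> b, y) \<le> T\<Omega> (\<gamma> a, y)"
proof (cases "\<gamma> constant_on {a..b}")
  case True
  then have "\<gamma> a = \<gamma> b" using assms by (auto simp: constant_on_def causal_path_def)
  then show ?thesis by simp
next
  case False
  then show ?thesis using assms curve_iff conformal_tau_mono_left by blast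
qed

end

section \<open>Time reversal\<close>

text \<open>
  One inequality suffices, here and for the conformal time separation, because reversing time twice
  gives back the original data.
\<close>

lemma weighted_length_reverse_le:
  "weighted_length \<tau> \<Omega> a b \<gamma> \<le> weighted_length (\<tau> \<circ> prod.swap) \<Omega> (- b) (- a) (\<gamma> \<circ> uminus)"
proof (rule weighted_length_greatest)
  fix m t assume t: "is_partition (- b) (- a) m t"
  define u where "u i = - t (m - i)" for i
  have u: "is_partition a b m u"
    unfolding is_partition_def
  proof (intro conjI allI impI)
    fix i assume "i < m"
    then have "t (m - Suc i) < t (Suc (m - Suc i))" "Suc (m - Suc i) = m - i"
      using t by (auto simp: is_partition_def)
    then show "u i < u (Suc i)" by (simp add: u_def)
  qed (use t in \<open>auto simp: is_partition_def u_def\<close>)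
  let ?f = "\<lambda>i. (SUP s\<in>{t i..t (Suc i)}. ennreal (\<Omega> (\<gamma> (- s)))) * \<tau> (\<gamma> (- t (Suc i)), \<gamma> (- t i))"
  have "partition_sum \<tau> \<Omega> \<gamma> m u = (\<Sum>i<m. ?f (m - Suc i))"
    unfolding partition_sum_def
  proof (intro sum.cong refl)
    fix i assume "i \<in> {..<m}"
    then have S: "Suc (m - Suc i) = m - i" by auto
    have "(\<lambda>s. ennreal (\<Omega> (\<gamma> s))) ` {u i..u (Suc i)}
        = (\<lambda>s. ennreal (\<Omega> (\<gamma> (- s)))) ` {t (m - Suc i)..t (m - i)}"
      unfolding u_def by (simp only: image_uminus_atLeastAtMost[symmetric] image_image)
    then show "(SUP s\<in>{u i..u (Suc i)}. ennreal (\<Omega> (\<gamma> s))) * \<tau> (\<gamma> (u i), \<gamma> (u (Suc i)))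
        = ?f (m - Suc i)"
      by (simp add: S) (simp add: u_def)
  qed
  also have "\<dots> = (\<Sum>i<m. ?f i)" by (rule sum.nat_diff_reindex)
  also have "\<dots> = partition_sum (\<tau> \<circ> prod.swap) \<Omega> (\<gamma> \<circ> uminus) m t"
    by (simp add: partition_sum_def)
  finally show "weighted_length \<tau> \<Omega> a b \<gamma> \<le> \<dots>"
    using weighted_length_le_partition_sum[OF u, of \<tau> \<Omega> \<gamma>] by simp
qed

lemma weighted_length_reverse:
  "weighted_length (\<tau> \<circ> prod.swap) \<Omega> (- b) (- a) (\<gamma> \<circ> uminus) = weighted_length \<tau> \<Omega> a b \<gamma>"
  using weighted_length_reverse_le[of \<tau> \<Omega> a b \<gamma>]
    weighted_length_reverse_le[of "\<tau> \<circ> prod.swap" \<Omega> "- b" "- a" "\<gamma> \<circ> uminus"]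
  by (simp add: comp_def)

lemma causal_curve_reverse:
  assumes "causal_curve le {a..b} \<gamma>"
  shows "causal_curve (\<lambda>x y. le y x) {- b..- a} (\<gamma> \<circ> uminus)"
proof -
  have im: "uminus ` {- b..- a} = {a..b}" by simp
  have "continuous_on {- b..- a} (\<gamma> \<circ> uminus)"
    by (rule continuous_on_compose) (use assms in \<open>auto simp: causal_curve_def intro!: continuous_intros\<close>)
  moreover have "\<not> (\<gamma> \<circ> uminus) constant_on {- b..- a}"
  proof
    assume "(\<gamma> \<circ> uminus) constant_on {- b..- a}"
    then obtain q where "\<And>s. s \<in> {- b..- a} \<Longrightarrow> \<gamma> (- s) = q" by (auto simp: constant_on_def)
    then have "\<gamma> s = q" if "s \<in> {a..b}" for s using that by (metis im imageE)
    then show False using assms by (auto simp: causal_curve_def constant_on_def)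
  qed
  ultimately show ?thesis using assms by (auto simp: causal_curve_def is_interval_cc)
qed

lemma causal_curve_from_to_reverse:
  assumes "causal_curve_from_to le a b \<gamma> x y"
  shows "causal_curve_from_to (\<lambda>x y. le y x) (- b) (- a) (\<gamma> \<circ> uminus) y x"
  using assms causal_curve_reverse by (auto simp: causal_curve_from_to_def)

lemma conformal_tau_reverse_le:
  "conformal_tau le \<tau> \<Omega> (x, y) \<le> conformal_tau (\<lambda>x y. le y x) (\<tau> \<circ> prod.swap) \<Omega> (y, x)"
proof (rule ccontr)
  assume "\<not> ?thesis"
  then have "conformal_tau (\<lambda>x y. le y x) (\<tau> \<circ> prod.swap) \<Omega> (y, x) < conformal_tau le \<tau> \<Omega> (x, y)"
    by simp
  then obtain a b \<gamma> where \<gamma>: "causal_curve_from_to le a b \<gamma> x y"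
    and less: "conformal_tau (\<lambda>x y. le y x) (\<tau> \<circ> prod.swap) \<Omega> (y, x) < weighted_length \<tau> \<Omega> a b \<gamma>"
    by (rule less_conformal_tauE)
  have "weighted_length \<tau> \<Omega> a b \<gamma> \<le> conformal_tau (\<lambda>x y. le y x) (\<tau> \<circ> prod.swap) \<Omega> (y, x)"
    using conformal_tau_ge_weighted_length[OF causal_curve_from_to_reverse[OF \<gamma>], of "\<tau> \<circ> prod.swap" \<Omega>]
    by (simp only: weighted_length_reverse)
  then show False using less by simp
qed

lemma conformal_tau_reverse:
  "conformal_tau (\<lambda>x y. le y x) (\<tau> \<circ> prod.swap) \<Omega> (y, x) = conformal_tau le \<tau> \<Omega> (x, y)"
  using conformal_tau_reverse_le[of le \<tau> \<Omega> x y]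
    conformal_tau_reverse_le[of "\<lambda>x y. le y x" "\<tau> \<circ> prod.swap" \<Omega> y x]
  by (simp add: comp_assoc)

text \<open>With \<open>\<Omega> = 1\<close>, reversal of the conformal time separation thus includes reversal of intrinsicness.\<close>

lemma intrinsic_iff_conformal_tau:
  "intrinsic le \<tau> \<longleftrightarrow> (\<forall>x y. \<tau> (x, y) = conformal_tau le \<tau> (\<lambda>_. 1) (x, y))"
  by (simp add: intrinsic_def conformal_tau_def tau_length_def)

lemma quasi_strongly_causal_reverse:
  assumes "quasi_strongly_causal le"
  shows "quasi_strongly_causal (\<lambda>x y. le y x)"
  unfolding quasi_strongly_causal_def
proof (intro allI impI)
  fix x and U :: "'a set" assume "x \<in> interior U"
  then obtain V where V: "x \<in> interior V" "V \<subseteq> U"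
    and VU: "\<And>a b \<gamma>. causal_curve le {a..b} \<gamma> \<Longrightarrow> \<gamma> a \<in> V \<Longrightarrow> \<gamma> b \<in> V \<Longrightarrow> \<gamma> ` {a..b} \<subseteq> U"
    using assms unfolding quasi_strongly_causal_def by meson
  have "\<gamma> ` {a..b} \<subseteq> U" if "causal_curve (\<lambda>x y. le y x) {a..b} \<gamma>" "\<gamma> a \<in> V" "\<gamma> b \<in> V" for a b \<gamma>
  proof -
    have "(\<gamma> \<circ> uminus) ` {- b..- a} \<subseteq> U"
      using VU[OF causal_curve_reverse[OF that(1)]] that by simp
    moreover have "(\<gamma> \<circ> uminus) ` {- b..- a} = \<gamma> ` {a..b}" by (simp only: image_comp[symmetric]) simp
    ultimately show ?thesis by simp
  qed
  then show "\<exists>V. x \<in> interior V \<and> V \<subseteq> U \<and>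
      (\<forall>a b \<gamma>. causal_curve (\<lambda>x y. le y x) {a..b} \<gamma> \<and> \<gamma> a \<in> V \<and> \<gamma> b \<in> V \<longrightarrow> \<gamma> ` {a..b} \<subseteq> U)"
    using V by blast
qed

lemma conformal_setting_reverse:
  assumes "conformal_setting chron causal \<tau> \<Omega>"
  shows "conformal_setting (\<lambda>x y. chron y x) (\<lambda>x y. causal y x) (\<tau> \<circ> prod.swap) \<Omega>"
proof -
  interpret conformal_setting chron causal \<tau> \<Omega> by fact
  show ?thesis
  proof unfold_locales
    show "lower_semicontinuous (\<tau> \<circ> prod.swap)"
      unfolding lower_semicontinuous_def
    proof (intro allI impI)
      fix p c assume "c < (\<tau> \<circ> prod.swap) p"
      moreover have "((\<lambda>q. (snd q, fst q)) \<longlongrightarrow> (snd p, fst p)) (nhds p)"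
        by (intro tendsto_Pair tendsto_fst tendsto_snd filterlim_ident)
      ultimately show "\<forall>\<^sub>F q in nhds p. c < (\<tau> \<circ> prod.swap) q"
        using lower_semicontinuous_tendsto[OF lsc_tau] by (fastforce simp: prod.swap_def)
    qed
    show "intrinsic (\<lambda>x y. causal y x) (\<tau> \<circ> prod.swap)"
      using intr by (simp add: intrinsic_iff_conformal_tau conformal_tau_reverse)
    show "quasi_strongly_causal (\<lambda>x y. causal y x)"
      using qsc by (rule quasi_strongly_causal_reverse)
    show "continuous_on UNIV \<Omega>" by (rule contO)
    fix x y z
    show "chron z x" if "chron y x" "chron z y" using that by (blast intro: chron_trans)
    show "causal z x" if "causal y x" "causal z y" using that by (blast intro: causal_trans)
    show "causal x x" by (rule causal_refl)
    show "causal y x" if "chron y x" using that by (rule chron_imp_causal)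
    show "(\<tau> \<circ> prod.swap) (x, y) + (\<tau> \<circ> prod.swap) (y, z) \<le> (\<tau> \<circ> prod.swap) (x, z)"
      if "causal y x" "causal z y"
      using reverse_triangle[OF that(2,1)] by (simp add: add.commute)
    show "(\<tau> \<circ> prod.swap) (x, y) = 0" if "\<not> causal y x" using tau_eq_0[OF that] by simp
    show "0 < (\<tau> \<circ> prod.swap) (x, y) \<longleftrightarrow> chron y x" by (simp add: tau_pos_iff)
    show "0 < \<Omega> x" by (rule posO)
  qed
qed

section \<open>Moving the endpoints\<close>

context conformal_setting
begin

lemma conformal_tau_path_mono_right:
  assumes "causal_path causal a b \<gamma>"
  shows "T\<Omega> (x, \<gamma> a) \<le> T\<Omega> (x, \<gamma> b)"
proof -
  interpret rev: conformal_setting "\<lambda>x y. y \<lless> x" "\<lambda>x y. y \<preceq> x" "\<tau> \<circ> prod.swap" \<Omega>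
    by (rule conformal_setting_reverse) unfold_locales
  have "continuous_on {- b..- a} (\<gamma> \<circ> uminus)"
    by (rule continuous_on_compose) (use assms in \<open>auto simp: causal_path_def intro!: continuous_intros\<close>)
  then have "causal_path (\<lambda>x y. y \<preceq> x) (- b) (- a) (\<gamma> \<circ> uminus)"
    using assms by (auto simp: causal_path_def)
  from rev.conformal_tau_path_mono_left[OF this, of x] show ?thesis
    by (simp add: conformal_tau_reverse)
qed

lemma conformal_tau_mono_right:
  assumes "causal_curve_from_to causal a b \<gamma> z y"
  shows "T\<Omega> (x, z) \<le> T\<Omega> (x, y)"
  using conformal_tau_path_mono_right[of a b \<gamma> x] assms curve_iff by auto

lemma tendsto_at_right_path:
  assumes \<gamma>: "causal_path causal a b \<gamma>" and ab: "a < b"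
  shows "(\<gamma> \<longlongrightarrow> \<gamma> a) (at_right a)"
  using assms continuous_on_Icc_at_rightD[of a b \<gamma>] by (simp add: causal_path_def)

text \<open>
  Let \<open>m\<close> be the infimum of the distances \<open>\<tau>(\<gamma>(a), \<gamma>(t))\<close> and \<open>0 < d < e\<close>. By lower
  semicontinuity there is \<open>s\<close> between \<open>a\<close> and \<open>t\<close> with \<open>\<tau>(\<gamma>(s), \<gamma>(t)) > d\<close>, so the reverse triangle
  inequality at \<open>\<gamma>(s)\<close> yields \<open>\<tau>(\<gamma>(a), \<gamma>(t)) \<ge> m + d\<close>. Thus \<open>m \<ge> m + d\<close>, which forces
  \<open>m = \<infinity>\<close>.
\<close>

lemma tau_top_of_uniform_bound:
  assumes \<gamma>: "causal_path causal a b \<gamma>" and ab: "a < b" and "0 < e"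
    and bound: "\<And>t. t \<in> {a<..b} \<Longrightarrow> e \<le> \<tau> (\<gamma> a, \<gamma> t)"
    and r: "r \<in> {a<..b}"
  shows "\<tau> (\<gamma> a, \<gamma> r) = top"
proof -
  define m where "m = (INF t\<in>{a<..b}. \<tau> (\<gamma> a, \<gamma> t))"
  obtain d where d: "0 < d" "d < e" using dense[OF \<open>0 < e\<close>] by blast
  have "m + d \<le> \<tau> (\<gamma> a, \<gamma> t)" if t: "t \<in> {a<..b}" for t
  proof -
    have "d < \<tau> (\<gamma> a, \<gamma> t)" using bound[OF t] d by simp
    then have "\<forall>\<^sub>F s in at_right a. d < \<tau> (\<gamma> s, \<gamma> t)"
      by (rule lower_semicontinuous_tendsto[OF lsc_tau tendsto_Pair[OF tendsto_at_right_path[OF \<gamma> ab] tendsto_const]])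
    moreover have "\<forall>\<^sub>F s in at_right a. s \<in> {a<..<t}"
      using t by (intro eventually_at_right_real) auto
    ultimately have "\<forall>\<^sub>F s in at_right a. d < \<tau> (\<gamma> s, \<gamma> t) \<and> s \<in> {a<..<t}"
      by (rule eventually_conj)
    then obtain s where s: "d < \<tau> (\<gamma> s, \<gamma> t)" "s \<in> {a<..<t}"
      using eventually_happens trivial_limit_at_right_real by blast
    have "m \<le> \<tau> (\<gamma> a, \<gamma> s)" unfolding m_def by (rule INF_lower) (use s t in auto)
    then have "m + d \<le> \<tau> (\<gamma> a, \<gamma> s) + \<tau> (\<gamma> s, \<gamma> t)"
      using s by (intro add_mono) auto
    also have "\<dots> \<le> \<tau> (\<gamma> a, \<gamma> t)"
      by (rule reverse_triangle) (use \<gamma> s t in \<open>auto simp: causal_path_def\<close>)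
    finally show ?thesis .
  qed
  then have "m + d \<le> m" by (subst (2) m_def) (rule INF_greatest)
  then have "m = top" using d(1)
    by (metis add.right_neutral ennreal_add_left_cancel_less infinity_ennreal_def leD)
  moreover have "m \<le> \<tau> (\<gamma> a, \<gamma> r)" unfolding m_def by (rule INF_lower) (rule r)
  ultimately show ?thesis by (simp add: top_unique)
qed

text \<open>
  The length of \<open>\<gamma>\<close> restricted to \<open>[s, b]\<close> need not be close to that on \<open>[a, b]\<close> for \<open>s\<close> near \<open>a\<close>, so
  the conclusion is about \<open>T\<Omega>\<close>, for which other curves compete. A drop of the length at \<open>a\<close> would
  give a uniform lower bound for the distances from \<open>\<gamma>(a)\<close> to later points, hence infinite
  distances, and then the local bound near \<open>\<gamma>(a)\<close> supplies curves that make \<open>T\<Omega>\<close> large.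
\<close>

lemma ex_later_point_conformal_tau_greater:
  assumes \<gamma>: "causal_path causal a b \<gamma>" and ab: "a < b" and c: "c < L\<Omega> a b \<gamma>"
  shows "\<exists>s\<in>{a<..b}. c < T\<Omega> (\<gamma> s, \<gamma> b)"
proof (rule ccontr)
  assume "\<not> ?thesis"
  then have low: "T\<Omega> (\<gamma> s, \<gamma> b) \<le> c" if "s \<in> {a<..b}" for s using that by (meson not_le)
  have "continuous_on {a..b} (\<lambda>s. \<Omega> (\<gamma> s))"
    by (rule continuous_on_compose2[OF contO]) (use \<gamma> in \<open>auto simp: causal_path_def\<close>)
  then have "bdd_above ((\<lambda>s. \<Omega> (\<gamma> s)) ` {a..b})"
    by (intro bounded_imp_bdd_above compact_imp_bounded compact_continuous_image) auto
  then obtain K where K: "\<And>s. s \<in> {a..b} \<Longrightarrow> \<Omega> (\<gamma> s) \<le> K"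
    unfolding bdd_above_def by (metis imageI)
  have K0: "0 < K" using K[of a] posO[of "\<gamma> a"] ab by simp
  have bound: "L\<Omega> a b \<gamma> - c \<le> ennreal K * \<tau> (\<gamma> a, \<gamma> t)" if t: "t \<in> {a<..b}" for t
  proof -
    have "causal_path causal t b \<gamma>" by (rule causal_path_subinterval[OF \<gamma>]) (use t in auto)
    then have "L\<Omega> t b \<gamma> \<le> T\<Omega> (\<gamma> t, \<gamma> b)" by (rule weighted_length_le_conformal_tau)
    also have "\<dots> \<le> c" using low t by auto
    finally have 1: "L\<Omega> t b \<gamma> \<le> c" .
    have 2: "(SUP s\<in>{a..t}. ennreal (\<Omega> (\<gamma> s))) \<le> ennreal K"
      by (intro SUP_least ennreal_leI K) (use t in auto)
    have "L\<Omega> a b \<gamma> \<le> (SUP s\<in>{a..t}. ennreal (\<Omega> (\<gamma> s))) * \<tau> (\<gamma> a, \<gamma> t) + L\<Omega> t b \<gamma>"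
      by (rule weighted_length_le_first_step) (use t in auto)
    also have "\<dots> \<le> ennreal K * \<tau> (\<gamma> a, \<gamma> t) + c"
      by (intro add_mono mult_right_mono 1 2) simp
    finally show ?thesis using c by (auto simp: ennreal_minus_le_iff add.commute)
  qed
  have infinite: "\<tau> (\<gamma> a, \<gamma> t) = top" if t: "t \<in> {a<..b}" for t
  proof (rule tau_top_of_uniform_bound[OF \<gamma> ab _ _ t])
    show "0 < (L\<Omega> a b \<gamma> - c) / ennreal K"
      using c K0 by (simp add: ennreal_zero_less_divide diff_gr0_ennreal)
    show "(L\<Omega> a b \<gamma> - c) / ennreal K \<le> \<tau> (\<gamma> a, \<gamma> t)" if "t \<in> {a<..b}" for t
      using bound[OF that] K0 by (intro divide_le_posI_ennreal) auto
  qed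
  obtain V k where V: "\<gamma> a \<in> interior V" "0 < k"
    and Vk: "\<And>u v. u \<in> V \<Longrightarrow> v \<in> V \<Longrightarrow> ennreal k * \<tau> (u, v) \<le> T\<Omega> (u, v)"
    using conformal_tau_local_bound by blast
  note lim = tendsto_at_right_path[OF \<gamma> ab]
  have near: "\<forall>\<^sub>F s in at_right a. \<gamma> s \<in> interior V"
    by (rule topological_tendstoD[OF lim]) (use V in auto)
  moreover have "\<forall>\<^sub>F s in at_right a. s \<in> {a<..<b}" using ab by (rule eventually_at_right_real)
  ultimately have "\<forall>\<^sub>F s in at_right a. \<gamma> s \<in> interior V \<and> s \<in> {a<..<b}" by (rule eventually_conj)
  then obtain t where t: "\<gamma> t \<in> interior V" "t \<in> {a<..<b}"
    using eventually_happens trivial_limit_at_right_real by blast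
  (* first t close to a, then s even closer: tau is large from s to t, and both points lie in V *)
  have "c \<noteq> top" using c by auto
  then have "c / ennreal k < \<tau> (\<gamma> a, \<gamma> t)"
    using infinite[of t] t V(2) by (simp add: less_top[symmetric] ennreal_divide_eq_top_iff)
  then have "\<forall>\<^sub>F s in at_right a. c / ennreal k < \<tau> (\<gamma> s, \<gamma> t)"
    by (rule lower_semicontinuous_tendsto[OF lsc_tau tendsto_Pair[OF lim tendsto_const]])
  moreover have "\<forall>\<^sub>F s in at_right a. s \<in> {a<..<t}" using t by (intro eventually_at_right_real) auto
  ultimately have "\<forall>\<^sub>F s in at_right a. \<gamma> s \<in> interior V \<and> c / ennreal k < \<tau> (\<gamma> s, \<gamma> t) \<and> s \<in> {a<..<t}"
    using near by eventually_elim auto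
  then obtain s where s: "\<gamma> s \<in> interior V" "c / ennreal k < \<tau> (\<gamma> s, \<gamma> t)" "s \<in> {a<..<t}"
    using eventually_happens trivial_limit_at_right_real by blast
  have "c < ennreal k * \<tau> (\<gamma> s, \<gamma> t)"
    using s(2) V(2) divide_less_ennreal[of "ennreal k" c "\<tau> (\<gamma> s, \<gamma> t)"] by (simp add: mult.commute)
  also have "\<dots> \<le> T\<Omega> (\<gamma> s, \<gamma> t)" by (rule Vk) (use s t interior_subset in blast)+
  also have "\<dots> \<le> T\<Omega> (\<gamma> s, \<gamma> b)"
    by (rule conformal_tau_path_mono_right, rule causal_path_subinterval[OF \<gamma>]) (use s t in auto)
  also have "\<dots> \<le> c" using low s t by auto
  finally show False by simp
qed

text \<open>
  The initial part of a long curve on which the points are not yet in the chronological future of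
  \<open>x\<close> contributes nothing to the length; the previous lemma applies to the remaining part.
\<close>

lemma ex_chron_future_point:
  assumes c: "c < T\<Omega> (x, y)"
  shows "\<exists>z. x \<lless> z \<and> c < T\<Omega> (z, y)"
proof (cases "x \<lless> x")
  case True
  then show ?thesis using c by blast
next
  case False
  obtain a b \<gamma> where curve: "causal_curve_from_to causal a b \<gamma> x y" and L: "c < L\<Omega> a b \<gamma>"
    using c by (rule less_conformal_tauE)
  then have \<gamma>: "causal_path causal a b \<gamma>" "\<gamma> a = x" "\<gamma> b = y" using curve_iff by auto
  have ab: "a \<le> b" using \<gamma> by (simp add: causal_path_def)
  have "0 < L\<Omega> a b \<gamma>" using L by (rule le_less_trans[rotated]) simp
  also note weighted_length_le_one_step[OF ab, of \<tau> \<Omega> \<gamma>]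
  finally have pos: "0 < \<tau> (\<gamma> a, \<gamma> b)" by (auto simp: zero_less_iff_neq_zero)
  (* S is an up-closed, relatively open subset of [a, b], so r is the last parameter outside S *)
  define S where "S = {t \<in> {a..b}. x \<lless> \<gamma> t}"
  have bS: "b \<in> S" using pos \<gamma> ab by (auto simp: S_def tau_pos_iff)
  have bdd: "bdd_below S" unfolding S_def by (auto intro!: bdd_belowI)
  define r where "r = Inf S"
  have "a \<le> r" unfolding r_def by (rule cInf_greatest) (use bS in \<open>auto simp: S_def\<close>)
  moreover have "r \<le> b" unfolding r_def using bS bdd by (rule cInf_lower)
  ultimately have r: "a \<le> r" "r \<le> b" .
  have after: "x \<lless> \<gamma> t" if "r < t" "t \<le> b" for t
  proof -
    have "S \<noteq> {}" using bS by auto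
    from cInf_lessD[OF this \<open>r < t\<close>[unfolded r_def]] obtain s where s: "s \<in> S" "s < t" by blast
    then have "\<gamma> s \<preceq> \<gamma> t" using \<gamma> that by (auto simp: S_def causal_path_def)
    moreover have "x \<lless> \<gamma> s" using s by (simp add: S_def)
    ultimately show ?thesis by (rule chron_causal_trans[rotated])
  qed
  have not_r: "\<not> x \<lless> \<gamma> r"
  proof
    assume xr: "x \<lless> \<gamma> r"
    then have "a \<noteq> r" using False \<gamma> by auto
    then have ar: "a < r" using r by simp
    have "causal_path causal a r \<gamma>" by (rule causal_path_subinterval[OF \<gamma>(1)]) (use r in auto)
    then have "(\<gamma> \<longlongrightarrow> \<gamma> r) (at_left r)"
      using continuous_on_Icc_at_leftD[of a r \<gamma>] ar by (simp add: causal_path_def)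
    from lower_semicontinuous_tendsto[OF lsc_tau tendsto_Pair[OF tendsto_const this], of 0 x]
    have "\<forall>\<^sub>F s in at_left r. 0 < \<tau> (x, \<gamma> s)" using xr by (simp add: tau_pos_iff)
    moreover have "\<forall>\<^sub>F s in at_left r. s \<in> {a<..<r}" using ar by (rule eventually_at_left_real)
    ultimately have "\<forall>\<^sub>F s in at_left r. 0 < \<tau> (x, \<gamma> s) \<and> s \<in> {a<..<r}" by (rule eventually_conj)
    then obtain s where s: "0 < \<tau> (x, \<gamma> s)" "s \<in> {a<..<r}"
      using eventually_happens trivial_limit_at_left_real by blast
    then have "s \<in> S" using r by (auto simp: S_def tau_pos_iff)
    then have "r \<le> s" unfolding r_def using bdd by (rule cInf_lower)
    then show False using s by simp
  qed
  have "r \<noteq> b" using not_r bS by (auto simp: S_def)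
  then have rb: "r < b" using r by simp
  have path: "causal_path causal r b \<gamma>" by (rule causal_path_subinterval[OF \<gamma>(1)]) (use r in auto)
  have "\<tau> (\<gamma> a, \<gamma> r) = 0" using not_r \<gamma> tau_pos_iff[of x "\<gamma> r"] by (simp add: zero_less_iff_neq_zero)
  then have "c < L\<Omega> r b \<gamma>"
    using L weighted_length_le_first_step[OF r(1), of \<tau> \<Omega> b \<gamma>] by simp
  with path rb obtain s where "s \<in> {r<..b}" "c < T\<Omega> (\<gamma> s, \<gamma> b)"
    using ex_later_point_conformal_tau_greater by blast
  then show ?thesis using after \<gamma> by auto
qed

lemma ex_chron_past_point:
  assumes "c < T\<Omega> (x, y)"
  shows "\<exists>z. z \<lless> y \<and> c < T\<Omega> (x, z)"
proof -
  interpret rev: conformal_setting "\<lambda>x y. y \<lless> x" "\<lambda>x y. y \<preceq> x" "\<tau> \<circ> prod.swap" \<Omega>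
    by (rule conformal_setting_reverse) unfold_locales
  show ?thesis
    using rev.ex_chron_future_point[of c y x] assms by (simp add: conformal_tau_reverse)
qed

lemma lower_semicontinuous_conformal_tau: "lower_semicontinuous T\<Omega>"
  unfolding lower_semicontinuous_def
proof (intro allI impI)
  fix p c assume "c < T\<Omega> p"
  moreover obtain x y where p: "p = (x, y)" by fastforce
  ultimately obtain z where z: "x \<lless> z" "c < T\<Omega> (z, y)" using ex_chron_future_point by blast
  from ex_chron_past_point[OF z(2)] obtain w where w: "w \<lless> y" "c < T\<Omega> (z, w)" by blast
  have "\<forall>\<^sub>F q in nhds p. 0 < \<tau> (fst q, z)"
    by (rule lower_semicontinuous_tendsto[OF lsc_tau, where l = "(x, z)"])
       (use z p in \<open>auto simp: tau_pos_iff intro!: tendsto_eq_intros filterlim_ident\<close>)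
  moreover have "\<forall>\<^sub>F q in nhds p. 0 < \<tau> (w, snd q)"
    by (rule lower_semicontinuous_tendsto[OF lsc_tau, where l = "(w, y)"])
       (use w p in \<open>auto simp: tau_pos_iff intro!: tendsto_eq_intros filterlim_ident\<close>)
  ultimately show "\<forall>\<^sub>F q in nhds p. c < T\<Omega> q"
  proof eventually_elim
    case (elim q)
    obtain x' y' where q: "q = (x', y')" by fastforce
    have x': "x' \<lless> z" and y': "w \<lless> y'" using elim q by (auto simp: tau_pos_iff)
    have "c < T\<Omega> (z, w)" by (rule w)
    also have "\<dots> \<le> T\<Omega> (x', w)"
      using x' by (rule chron_imp_curve) (rule conformal_tau_mono_left)
    also have "\<dots> \<le> T\<Omega> (x', y')"
      using y' by (rule chron_imp_curve) (rule conformal_tau_mono_right)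
    finally show ?case by (simp add: q)
  qed
qed

end

theorem proposition3p11:
  fixes chron causal :: "'a::metric_space \<Rightarrow> 'a \<Rightarrow> bool"
    and \<tau> :: "'a \<times> 'a \<Rightarrow> ennreal"
    and \<Omega> :: "'a \<Rightarrow> real"
  assumes "lorentzian_pre_length_space chron causal \<tau>"
    and "intrinsic causal \<tau>"
    and "quasi_strongly_causal causal"
    and "continuous_on UNIV \<Omega>"
    and "\<forall>x. \<Omega> x > 0"
  shows "lower_semicontinuous (conformal_tau causal \<tau> \<Omega>)"
proof -
  interpret lorentzian_pre_length_space chron causal \<tau> by fact
  interpret conformal_setting chron causal \<tau> \<Omega>
    by unfold_locales (use assms in auto)
  show ?thesis by (rule lower_semicontinuous_conformal_tau)
qed

end
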